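(* Let $N$ be a network of the session calculus that is guardedly well-typed and race-free. Then $N$ satisfies $\mathcal{L}(\mathrm{J})$.
   Context: Session calculus. Fix sets of locations $p,q,r,\dots$, labels $\lambda,\mu$ and recursion variables $X,Y$. Threads: $P ::= \mathbf{end} \mid \bigoplus_{i\in I} p_i!\lambda_i;P_i \mid \sum_{i\in I} p_i?\lambda_i;P_i \mid X \mid \mu X.P$, with $I$ finite (nonempty for $\bigoplus$) and expressions $\mu X.X$, $\mu X.\mu Y.P$ excluded. Networks: $N ::= p[\![P]\!] \mid 0 \mid N\parallel N$; $p$ is a location of $N$ if $p[\![P]\!]$ occurs in $N$; in a network all locations are distinct, all threads are closed, and every location named in a send $p!\lambda$ or receive $p?\lambda$ is a location of $N$. Thread states additionally allow the form $\langle q!\lambda\rangle;P$ (an output already selected); network states are built from located thread states likewise. Network states are taken modulo the structural congruence $\equiv$ given by associativity and commutativity of $\parallel$ and $N\parallel 0\equiv N$. $\mathrm{proc}(p,N)$ is the unique thread state $P$ with $N\equiv p[\![P]\!]\parallel N'$. The transition relation is the least relation closed under $\equiv$ containing, for all $N$: (choice) $p[\![\bigoplus_{i\in I}p_i!\lambda_i;P_i]\!]\parallel N \xrightarrow{\tau} p[\![\langle p_k!\lambda_k\rangle;P_k]\!]\parallel N$ for $k\in I$; (unfold) $p[\![\mu X.P]\!]\parallel N\xrightarrow{\tau} p[\![P\{\mu X.P/X\}]\!]\parallel N$; (comm) $p_k[\![\langle q!\lambda_k\rangle;Q]\!]\parallel q[\![\sum_{i\in I}p_i?\lambda_i;P_i]\!]\parallel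 N \xrightarrow{(p_k,\lambda_k,q)} p_k[\![Q]\!]\parallel q[\![P_k]\!]\parallel N$ for $k\in I$. For a transition $t$, $\mathrm{comp}(t)$ is the single location moving in a $\tau$-transition, and $\{p,q\}$ for a transition labelled $(p,\lambda,q)$; $t$ involves $p$ if $p\in\mathrm{comp}(t)$; transitions $t,u$ are concurrent if $\mathrm{comp}(t)\cap\mathrm{comp}(u)=\emptyset$. A path is a network state $N_0$ with a maximal (infinite, or ending in a state without outgoing transitions) sequence of transitions $N_i\xrightarrow{\alpha_i}N_{i+1}$. A location $p$ successfully terminates on a path if $\mathrm{proc}(p,N_i)=\mathbf{end}$ for some state $N_i$ on it. Justness: a path $\pi$ is just if for every suffix of $\pi$ starting in a state $s$ and every transition $t$ enabled in $s$, that suffix contains a transition $u$ not concurrent with $t$. For a fairness assumption $F$ (a designated set of "$F$-fair" paths), a network $N$ satisfies $\mathcal{L}(F)$ if for every $F$-fair path $\pi$ starting in $N$ and every location $p$ of $N$, either $p$ successfully terminates on $\pi$ or $\pi$ contains infinitely many transitions involving $p$. $\mathcal{L}(\mathrm{J})$ uses the just paths as fair paths. Races: a network state $N$ has a race if $N\xrightarrow{(p,\lambda,r)}N'$ and $N\xrightarrow{(q,\mu,r)}N''$ with $p\neq q$ or $N'\neq N''$. A network (state) is race-free if no network state reachable from it has a race. Global types: $G ::= \mathbf{end} \mid \boxplus_{i\in I} p\to q_i{:}\lambda_i;G_i \mid X \mid \mu X.G$, $I$ finite nonempty, $p\neq q_i$, $\mu X.X$ and $\mu X.\mu Y.G$ excluded.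 Participants: $\mathrm{pt}(\mathbf{end})=\mathrm{pt}(X)=\emptyset$, $\mathrm{pt}(\mu X.G)=\mathrm{pt}(G)$, $\mathrm{pt}(\boxplus_{i\in I}p\to q_i{:}\lambda_i;G_i)=\bigcup_{i}(\{p,q_i\}\cup\mathrm{pt}(G_i))$. Projection types are like threads but with receives only of the unary form $p?\lambda;Q$, plus a merge $\sqcap_{i\in I}Q_i$. Projection $G\upharpoonright r$: $\mathbf{end}\upharpoonright r=\mathbf{end}$; $X\upharpoonright r=X$; $(\mu X.G)\upharpoonright r=\mathbf{end}$ if $r\notin\mathrm{pt}(G)$ and $\mu X.G$ is closed, else $\mu X.(G\upharpoonright r)$; $(\boxplus_{i\in I}p\to q_i{:}\lambda_i;G_i)\upharpoonright r$ equals $\bigoplus_{i\in I}q_i!\lambda_i;(G_i\upharpoonright r)$ if $r=p$, and otherwise $\sqcap_{i\in I}((p\to q_i{:}\lambda_i;G_i)\upharpoonright r)$, where for a single branch $(p\to q{:}\lambda;G)\upharpoonright r$ is $p?\lambda;(G\upharpoonright r)$ if $r=q$ and $G\upharpoonright r$ if $r\notin\{p,q\}$. The judgement $P\vdash Q$ (thread state vs projection type) is the largest relation closed under the rules: $P\{\mu X.P/X\}\vdash Q \Rightarrow \mu X.P\vdash Q$; $P\vdash Q\{\mu X.Q/X\}\Rightarrow P\vdash \mu X.Q$; $\mathbf{end}\vdash\mathbf{end}$; ($i\in I$, $P_i\vdash Q_i$) $\Rightarrow \sum_{i\in I}p_i?\lambda_i;P_i\vdash p_i?\lambda_i;Q_i$;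 ($I\subseteq J$, $P_i\vdash Q_i$ for all $i\in I$) $\Rightarrow \bigoplus_{i\in I}p_i!\lambda_i;P_i\vdash\bigoplus_{i\in J}p_i!\lambda_i;Q_i$; ($P\vdash Q_i$ for all $i\in I$) $\Rightarrow P\vdash\sqcap_{i\in I}Q_i$; ($k\in I$, $P_k\vdash Q_k$) $\Rightarrow \langle q_k!\lambda_k\rangle;P_k\vdash\bigoplus_{i\in I}q_i!\lambda_i;Q_i$. A projection type is guarded if every occurrence of a variable $X$ inside a subexpression $\mu X.Q$ lies within a subexpression $p!\lambda;Q'$ or $p?\lambda;Q'$. A network (state) $N$ with locations $p_1,\dots,p_n$ satisfies $N\vdash G$ if $G$ is closed, $\mathrm{pt}(G)\subseteq\{p_1,\dots,p_n\}$ and $\mathrm{proc}(p_i,N)\vdash G\upharpoonright p_i$ for all $i$; $N\vdash_g G$ (guardedly well-typed w.r.t. $G$) if moreover every $G\upharpoonright p_i$ is guarded; $N$ is guardedly well-typed if $N\vdash_g G$ for some $G$. *)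

theory Defs
  imports Main "HOL-Library.Extended_Nat"
begin

text \<open>Thread states over locations 'l, labels 'a and recursion variables 'v.
  A finite indexed family of branches is represented by a list (index set = list positions).
  TSel q lam P is the thread state with an already selected output.\<close>

datatype ('l, 'a, 'v) thread =
    TEnd
  | TSend "('l \<times> 'a \<times> ('l, 'a, 'v) thread) list"
  | TRecv "('l \<times> 'a \<times> ('l, 'a, 'v) thread) list"
  | TVar 'v
  | TMu 'v "('l, 'a, 'v) thread"
  | TSel 'l 'a "('l, 'a, 'v) thread"

fun tfv :: "('l, 'a, 'v) thread \<Rightarrow> 'v set" where
  "tfv TEnd = {}"
| "tfv (TSend bs) = (\<Union>b\<in>set bs. tfv (snd (snd b)))"
| "tfv (TRecv bs) = (\<Union>b\<in>set bs. tfv (snd (snd b)))"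
| "tfv (TVar X) = {X}"
| "tfv (TMu X P) = tfv P - {X}"
| "tfv (TSel q l P) = tfv P"

text \<open>Substitution P{R/X}; it is only ever applied with closed R, so no capture can occur.\<close>
fun tsubst :: "'v \<Rightarrow> ('l, 'a, 'v) thread \<Rightarrow> ('l, 'a, 'v) thread \<Rightarrow> ('l, 'a, 'v) thread" where
  "tsubst X R TEnd = TEnd"
| "tsubst X R (TSend bs) = TSend (map (\<lambda>b. (fst b, fst (snd b), tsubst X R (snd (snd b)))) bs)"
| "tsubst X R (TRecv bs) = TRecv (map (\<lambda>b. (fst b, fst (snd b), tsubst X R (snd (snd b)))) bs)"
| "tsubst X R (TVar Y) = (if X = Y then R else TVar Y)"
| "tsubst X R (TMu Y P) = (if X = Y then TMu Y P else TMu Y (tsubst X R P))"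
| "tsubst X R (TSel q l P) = TSel q l (tsubst X R P)"

fun tlocs :: "('l, 'a, 'v) thread \<Rightarrow> 'l set" where
  "tlocs TEnd = {}"
| "tlocs (TSend bs) = (\<Union>b\<in>set bs. insert (fst b) (tlocs (snd (snd b))))"
| "tlocs (TRecv bs) = (\<Union>b\<in>set bs. insert (fst b) (tlocs (snd (snd b))))"
| "tlocs (TVar X) = {}"
| "tlocs (TMu X P) = tlocs P"
| "tlocs (TSel q l P) = insert q (tlocs P)"

fun is_thread :: "('l, 'a, 'v) thread \<Rightarrow> bool" where
  "is_thread TEnd = True"
| "is_thread (TSend bs) = (bs \<noteq> [] \<and> (\<forall>b\<in>set bs. is_thread (snd (snd b))))"
| "is_thread (TRecv bs) = (\<forall>b\<in>set bs. is_thread (snd (snd b)))"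
| "is_thread (TVar X) = True"
| "is_thread (TMu X P) = ((\<forall>Y. P \<noteq> TVar Y) \<and> (\<forall>Y P'. P \<noteq> TMu Y P') \<and> is_thread P)"
| "is_thread (TSel q l P) = False"

text \<open>A network state modulo structural congruence is a finite partial map from
  locations to thread states; proc(p,N) = the (N p); p is a location of N iff p \<in> dom N.\<close>
type_synonym ('l, 'a, 'v) net = "'l \<rightharpoonup> ('l, 'a, 'v) thread"

definition is_network :: "('l, 'a, 'v) net \<Rightarrow> bool" where
  "is_network N \<longleftrightarrow> finite (dom N) \<and>
     (\<forall>p P. N p = Some P \<longrightarrow> is_thread P \<and> tfv P = {} \<and> tlocs P \<subseteq> dom N)"

text \<open>Transition labels: tau-steps are annotated with the moving location (which is
  determined by the transition anyway), communications are (p, lambda, q).\<close>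
datatype ('l, 'a) act = Tau 'l | Comm 'l 'a 'l

fun comp :: "('l, 'a) act \<Rightarrow> 'l set" where
  "comp (Tau p) = {p}"
| "comp (Comm p l q) = {p, q}"

inductive step :: "('l, 'a, 'v) net \<Rightarrow> ('l, 'a) act \<Rightarrow> ('l, 'a, 'v) net \<Rightarrow> bool" where
  choice: "\<lbrakk> N p = Some (TSend bs); k < length bs; bs ! k = (q, l, P) \<rbrakk>
           \<Longrightarrow> step N (Tau p) (N(p \<mapsto> TSel q l P))"
| unfold: "N p = Some (TMu X P) \<Longrightarrow> step N (Tau p) (N(p \<mapsto> tsubst X (TMu X P) P))"
| comm: "\<lbrakk> p \<noteq> q; N p = Some (TSel q l Q); N q = Some (TRecv bs); k < length bs;
           bs ! k = (p, l, P) \<rbrakk>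
           \<Longrightarrow> step N (Comm p l q) (N(p \<mapsto> Q, q \<mapsto> P))"

definition is_path :: "('l, 'a, 'v) net \<Rightarrow> (nat \<Rightarrow> ('l, 'a, 'v) net) \<Rightarrow> (nat \<Rightarrow> ('l, 'a) act) \<Rightarrow> enat \<Rightarrow> bool" where
  "is_path N0 s a n \<longleftrightarrow> s 0 = N0 \<and>
     (\<forall>i. enat i < n \<longrightarrow> step (s i) (a i) (s (Suc i))) \<and>
     (\<forall>m. n = enat m \<longrightarrow> (\<forall>\<alpha> N'. \<not> step (s m) \<alpha> N'))"

definition just :: "(nat \<Rightarrow> ('l, 'a, 'v) net) \<Rightarrow> (nat \<Rightarrow> ('l, 'a) act) \<Rightarrow> enat \<Rightarrow> bool" where
  "just s a n \<longleftrightarrow> (\<forall>k. enat k \<le> n \<longrightarrow> (\<forall>\<alpha> N'. step (s k) \<alpha> N' \<longrightarrow>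
       (\<exists>j. k \<le> j \<and> enat j < n \<and> comp (a j) \<inter> comp \<alpha> \<noteq> {})))"

definition satisfies_LJ :: "('l, 'a, 'v) net \<Rightarrow> bool" where
  "satisfies_LJ N \<longleftrightarrow> (\<forall>s a n. is_path N s a n \<and> just s a n \<longrightarrow>
     (\<forall>p\<in>dom N. (\<exists>i. enat i \<le> n \<and> s i p = Some TEnd) \<or>
                infinite {j. enat j < n \<and> p \<in> comp (a j)}))"

definition has_race :: "('l, 'a, 'v) net \<Rightarrow> bool" where
  "has_race N \<longleftrightarrow> (\<exists>p q r l m N' N''. step N (Comm p l r) N' \<and> step N (Comm q m r) N'' \<and>
       (p \<noteq> q \<or> N' \<noteq> N''))"

definition reachable :: "('l, 'a, 'v) net \<Rightarrow> ('l, 'a, 'v) net \<Rightarrow> bool" where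
  "reachable N M \<longleftrightarrow> (\<lambda>A B. \<exists>\<alpha>. step A \<alpha> B)\<^sup>*\<^sup>* N M"

definition race_free :: "('l, 'a, 'v) net \<Rightarrow> bool" where
  "race_free N \<longleftrightarrow> (\<forall>M. reachable N M \<longrightarrow> \<not> has_race M)"

text \<open>GCom p bs is the choice \<boxplus>_{i} p \<rightarrow> q_i : lambda_i ; G_i with bs = [(q_i, lambda_i, G_i)].\<close>
datatype ('l, 'a, 'v) gtype =
    GEnd
  | GCom 'l "('l \<times> 'a \<times> ('l, 'a, 'v) gtype) list"
  | GVar 'v
  | GMu 'v "('l, 'a, 'v) gtype"

fun is_gtype :: "('l, 'a, 'v) gtype \<Rightarrow> bool" where
  "is_gtype GEnd = True"
| "is_gtype (GCom p bs) = (bs \<noteq> [] \<and> (\<forall>b\<in>set bs. fst b \<noteq> p \<and> is_gtype (snd (snd b))))"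
| "is_gtype (GVar X) = True"
| "is_gtype (GMu X G) = ((\<forall>Y. G \<noteq> GVar Y) \<and> (\<forall>Y G'. G \<noteq> GMu Y G') \<and> is_gtype G)"

fun gfv :: "('l, 'a, 'v) gtype \<Rightarrow> 'v set" where
  "gfv GEnd = {}"
| "gfv (GCom p bs) = (\<Union>b\<in>set bs. gfv (snd (snd b)))"
| "gfv (GVar X) = {X}"
| "gfv (GMu X G) = gfv G - {X}"

fun pt :: "('l, 'a, 'v) gtype \<Rightarrow> 'l set" where
  "pt GEnd = {}"
| "pt (GCom p bs) = (\<Union>b\<in>set bs. {p, fst b} \<union> pt (snd (snd b)))"
| "pt (GVar X) = {}"
| "pt (GMu X G) = pt G"

datatype ('l, 'a, 'v) ptype =
    PEnd
  | PSend "('l \<times> 'a \<times> ('l, 'a, 'v) ptype) list"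
  | PRecv 'l 'a "('l, 'a, 'v) ptype"
  | PVar 'v
  | PMu 'v "('l, 'a, 'v) ptype"
  | PMerge "('l, 'a, 'v) ptype list"

fun psubst :: "'v \<Rightarrow> ('l, 'a, 'v) ptype \<Rightarrow> ('l, 'a, 'v) ptype \<Rightarrow> ('l, 'a, 'v) ptype" where
  "psubst X R PEnd = PEnd"
| "psubst X R (PSend bs) = PSend (map (\<lambda>b. (fst b, fst (snd b), psubst X R (snd (snd b)))) bs)"
| "psubst X R (PRecv p l Q) = PRecv p l (psubst X R Q)"
| "psubst X R (PVar Y) = (if X = Y then R else PVar Y)"
| "psubst X R (PMu Y Q) = (if X = Y then PMu Y Q else PMu Y (psubst X R Q))"
| "psubst X R (PMerge Qs) = PMerge (map (psubst X R) Qs)"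

fun proj :: "('l, 'a, 'v) gtype \<Rightarrow> 'l \<Rightarrow> ('l, 'a, 'v) ptype" where
  "proj GEnd r = PEnd"
| "proj (GVar X) r = PVar X"
| "proj (GMu X G) r = (if r \<notin> pt G \<and> gfv (GMu X G) = {} then PEnd else PMu X (proj G r))"
| "proj (GCom p bs) r =
     (if r = p then PSend (map (\<lambda>b. (fst b, fst (snd b), proj (snd (snd b)) r)) bs)
      else PMerge (map (\<lambda>b. if r = fst b then PRecv p (fst (snd b)) (proj (snd (snd b)) r)
                           else proj (snd (snd b)) r) bs))"

fun unguarded_vars :: "('l, 'a, 'v) ptype \<Rightarrow> 'v set" where
  "unguarded_vars PEnd = {}"
| "unguarded_vars (PSend bs) = {}"
| "unguarded_vars (PRecv p l Q) = {}"
| "unguarded_vars (PVar X) = {X}"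
| "unguarded_vars (PMu Y Q) = unguarded_vars Q"
| "unguarded_vars (PMerge Qs) = (\<Union>Q\<in>set Qs. unguarded_vars Q)"

fun guarded :: "('l, 'a, 'v) ptype \<Rightarrow> bool" where
  "guarded PEnd = True"
| "guarded (PSend bs) = (\<forall>b\<in>set bs. guarded (snd (snd b)))"
| "guarded (PRecv p l Q) = guarded Q"
| "guarded (PVar X) = True"
| "guarded (PMu X Q) = (X \<notin> unguarded_vars Q \<and> guarded Q)"
| "guarded (PMerge Qs) = (\<forall>Q\<in>set Qs. guarded Q)"

coinductive typed :: "('l, 'a, 'v) thread \<Rightarrow> ('l, 'a, 'v) ptype \<Rightarrow> bool" where
  unfoldL: "typed (tsubst X (TMu X P) P) Q \<Longrightarrow> typed (TMu X P) Q"
| unfoldR: "typed P (psubst X (PMu X Q) Q) \<Longrightarrow> typed P (PMu X Q)"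
| endT: "typed TEnd PEnd"
| recvT: "\<lbrakk> i < length bs; bs ! i = (p, l, P); typed P Q \<rbrakk> \<Longrightarrow> typed (TRecv bs) (PRecv p l Q)"
| sendT: "\<lbrakk> inj_on f {..<length bs};
            \<forall>i<length bs. f i < length cs \<and> fst (cs ! f i) = fst (bs ! i)
               \<and> fst (snd (cs ! f i)) = fst (snd (bs ! i))
               \<and> typed (snd (snd (bs ! i))) (snd (snd (cs ! f i))) \<rbrakk>
          \<Longrightarrow> typed (TSend bs) (PSend cs)"
| mergeT: "\<forall>i<length Qs. typed P (Qs ! i) \<Longrightarrow> typed P (PMerge Qs)"
| selT: "\<lbrakk> k < length cs; cs ! k = (q, l, Q); typed P Q \<rbrakk> \<Longrightarrow> typed (TSel q l P) (PSend cs)"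

definition net_typed :: "('l, 'a, 'v) net \<Rightarrow> ('l, 'a, 'v) gtype \<Rightarrow> bool" where
  "net_typed N G \<longleftrightarrow> gfv G = {} \<and> pt G \<subseteq> dom N \<and>
     (\<forall>p\<in>dom N. typed (the (N p)) (proj G p))"

definition net_gtyped :: "('l, 'a, 'v) net \<Rightarrow> ('l, 'a, 'v) gtype \<Rightarrow> bool" where
  "net_gtyped N G \<longleftrightarrow> net_typed N G \<and> (\<forall>p\<in>dom N. guarded (proj G p))"

definition guardedly_well_typed :: "('l, 'a, 'v) net \<Rightarrow> bool" where
  "guardedly_well_typed N \<longleftrightarrow> (\<exists>G. is_gtype G \<and> net_gtyped N G)"

end

theory Submission
  imports Defs
begin

text \<open>A just path need not execute the actions of the global type in their order, so it is
  compared with the global type along cuts: a cut assigns to each location a time such that no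
  communication is split, and the location states at those times are typed by the projections of
  a residual global type. Justness and race-freedom force the first action of the residual type
  to be the next communication of both of its participants, so the cut can be advanced past it.
  By guardedness, a location that has not terminated is reached within boundedly many such
  advances, so it communicates again and again.\<close>

section \<open>Threads\<close>

lemma thread_induct [case_names TEnd TSend TRecv TVar TMu TSel]:
  fixes P :: "('l, 'a, 'v) thread"
  assumes "Q TEnd"
    and "\<And>bs. (\<And>b. b \<in> set bs \<Longrightarrow> Q (snd (snd b))) \<Longrightarrow> Q (TSend bs)"
    and "\<And>bs. (\<And>b. b \<in> set bs \<Longrightarrow> Q (snd (snd b))) \<Longrightarrow> Q (TRecv bs)"
    and "\<And>X. Q (TVar X)"
    and "\<And>X P. Q P \<Longrightarrow> Q (TMu X P)"
    and "\<And>q l P. Q P \<Longrightarrow> Q (TSel q l P)"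
  shows "Q P"
proof (induction P)
  case (TSend bs)
  show ?case by (rule assms(2), rule TSend) (auto simp: snds.simps)
next
  case (TRecv bs)
  show ?case by (rule assms(3), rule TRecv) (auto simp: snds.simps)
qed (use assms in auto)

text \<open>The body of a recursion is not a variable, so substitution keeps its head and cannot
  produce a forbidden \<open>TMu X (TMu Y P)\<close>.\<close>

lemma is_thread_tsubst:
  "is_thread P \<Longrightarrow> is_thread R \<Longrightarrow> is_thread (tsubst X R P)"
proof (induction P rule: thread_induct)
  case (TMu Y P)
  then show ?case by (cases P) (auto split: if_splits)
qed fastforce+

lemma tfv_tsubst: "tfv (tsubst X R P) \<subseteq> (tfv P - {X}) \<union> tfv R"
  by (induction P rule: thread_induct) (simp | fastforce)+

text \<open>The invariant of the thread states met along a run: closed, with a selected output at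
  most at the head.\<close>

definition tstate :: "('l, 'a, 'v) thread \<Rightarrow> bool" where
  "tstate P \<longleftrightarrow> tfv P = {} \<and> (is_thread P \<or> (\<exists>q l P'. P = TSel q l P' \<and> is_thread P'))"

inductive ltau :: "('l, 'a, 'v) thread \<Rightarrow> ('l, 'a, 'v) thread \<Rightarrow> bool" where
  ltau_choice: "(q, l, P) \<in> set bs \<Longrightarrow> ltau (TSend bs) (TSel q l P)"
| ltau_unfold: "ltau (TMu X P) (tsubst X (TMu X P) P)"

lemma tstate_ltau: "ltau P P' \<Longrightarrow> tstate P \<Longrightarrow> tstate P'"
proof (induction rule: ltau.induct)
  case (ltau_choice q l P bs)
  then show ?case by (force simp: tstate_def)
next
  case (ltau_unfold X P)
  then show ?case
    using tfv_tsubst[of X "TMu X P" P] by (auto simp: tstate_def intro!: is_thread_tsubst)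
qed

text \<open>Every silent step lowers this rank because nested and immediate recursion is excluded.\<close>

fun rank :: "('l, 'a, 'v) thread \<Rightarrow> nat" where
  "rank (TMu X P) = 2"
| "rank (TSend bs) = 1"
| "rank _ = 0"

lemma rank_ltau: "ltau P P' \<Longrightarrow> tstate P \<Longrightarrow> rank P' < rank P"
proof (induction rule: ltau.induct)
  case (ltau_unfold X P)
  then show ?case by (cases P) (auto simp: tstate_def)
qed simp

lemma ltau_exists: "rank P > 0 \<Longrightarrow> tstate P \<Longrightarrow> \<exists>P'. ltau P P'"
proof (cases P)
  case (TSend bs)
  assume "tstate P"
  then obtain q l P' where "(q, l, P') \<in> set bs"
    using TSend by (cases bs) (auto simp: tstate_def)
  then show ?thesis using TSend by (auto intro: ltau_choice)
qed (auto intro: ltau_unfold)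

lemma rank_zero_stuck: "rank P = 0 \<Longrightarrow> ltau\<^sup>*\<^sup>* P P' \<Longrightarrow> P' = P"
  by (erule converse_rtranclpE) (auto elim: ltau.cases)

section \<open>The typing judgement\<close>

text \<open>By coinduction, since \<open>mergeT\<close> and \<open>unfoldR\<close> keep the thread
  and only change the projection type; a choice turns \<open>sendT\<close> into
  \<open>selT\<close>.\<close>

lemma typed_ltau:
  assumes "ltau P P'" and "typed P Q"
  shows "typed P' Q"
  using assms(2,1)
proof (coinduction arbitrary: P P' Q rule: typed.coinduct)
  case typed
  from typed(1) show ?case
  proof cases
    case (unfoldL X R)
    then have "P' = tsubst X (TMu X R) R" using typed(2) by (auto elim: ltau.cases)
    with unfoldL have "typed P' Q" by simp
    then show ?thesis
      \<comment> \<open>\<open>P'\<close> is already typed; its judgement is unrolled once and every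
        premise is put into the second disjunct.\<close>
      by (subst (asm) typed.simps)
        (elim disj_forward ex_forward conj_forward all_forward imp_forward; (assumption | rule disjI2))
  next
    case (unfoldR X R)
    then show ?thesis using typed(2) by auto
  next
    case (sendT f bs cs)
    then obtain q l R where P': "P' = TSel q l R" and "(q, l, R) \<in> set bs"
      using typed(2) by (auto elim: ltau.cases)
    then obtain i where i: "i < length bs" "bs ! i = (q, l, R)" by (auto simp: in_set_conv_nth)
    with sendT(4) have "f i < length cs" "fst (cs ! f i) = q" "fst (snd (cs ! f i)) = l"
      "typed R (snd (snd (cs ! f i)))" by auto
    then show ?thesis using sendT(2) P' by (metis prod.collapse)
  next
    case (mergeT Qs)
    then show ?thesis using typed(2) by auto
  qed (use typed(2) in \<open>auto elim: ltau.cases\<close>)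
qed

lemma typed_ltaus: "ltau\<^sup>*\<^sup>* P P' \<Longrightarrow> typed P Q \<Longrightarrow> typed P' Q"
  by (induction rule: rtranclp_induct) (auto intro: typed_ltau)

lemma tstate_unfold_not_TMu:
  assumes "tstate (TMu X P)"
  shows "tsubst X (TMu X P) P \<noteq> TMu Y R"
  using assms by (cases P) (auto simp: tstate_def)

text \<open>Inverting the judgement at a recursive thread may just return \<open>unfoldL\<close>. By
  \<open>tstate\<close>, one unfolding exposes another head; the result is folded back with
  \<open>unfoldL\<close>.\<close>

lemma typed_cases_head:
  assumes "typed P Q" and "tstate P"
    and "\<And>P'. typed P' Q \<Longrightarrow> (\<And>X R. P' \<noteq> TMu X R) \<Longrightarrow> typed P' Q'"
  shows "typed P Q'"
proof (cases "\<exists>X R. P = TMu X R")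
  case True
  then obtain X R where P: "P = TMu X R" by blast
  have "typed (tsubst X P R) Q"
    using assms(1) typed_ltau[OF ltau_unfold] by (simp add: P)
  then have "typed (tsubst X P R) Q'"
    using assms(2) by (intro assms(3)) (simp_all add: P tstate_unfold_not_TMu)
  then show ?thesis by (simp add: P typed.unfoldL)
qed (use assms in blast)

lemma typed_PMerge:
  assumes "typed P (PMerge Qs)" and "tstate P" and "Q \<in> set Qs"
  shows "typed P Q"
proof (rule typed_cases_head[OF assms(1,2)])
  fix P' :: "('a, 'b, 'c) thread"
  assume "typed P' (PMerge Qs)" and "\<And>X R. P' \<noteq> TMu X R"
  then show "typed P' Q" using assms(3)
    by cases (auto simp: in_set_conv_nth)
qed

lemma typed_PMu:
  assumes "typed P (PMu X Q)" and "tstate P"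
  shows "typed P (psubst X (PMu X Q) Q)"
proof (rule typed_cases_head[OF assms])
  fix P' :: "('a, 'b, 'c) thread"
  assume "typed P' (PMu X Q)" and "\<And>X R. P' \<noteq> TMu X R"
  then show "typed P' (psubst X (PMu X Q) Q)" by cases auto
qed

lemma typed_PEnd_rank0: "typed P PEnd \<Longrightarrow> rank P = 0 \<Longrightarrow> P = TEnd"
  by (erule typed.cases) auto

text \<open>Rank 0 rules out \<open>sendT\<close> and \<open>unfoldL\<close>, which leaves
  \<open>selT\<close>.\<close>

lemma typed_PSend_rank0:
  assumes "typed P (PSend cs)" and "rank P = 0"
  obtains q l Q R where "P = TSel q l R" and "(q, l, Q) \<in> set cs" and "typed R Q"
  using assms by (cases rule: typed.cases) (force simp: in_set_conv_nth)+

lemma typed_PRecv_rank0: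
  assumes "typed P (PRecv p l Q)" and "rank P = 0"
  obtains bs R where "P = TRecv bs" and "(p, l, R) \<in> set bs" and "typed R Q"
  using assms(1)
proof cases
  case (recvT i bs R)
  then have "(p, l, R) \<in> set bs" by (metis nth_mem)
  then show ?thesis using that recvT by blast
qed (use assms(2) in auto)

section \<open>Global types and their projections\<close>

lemma gtype_induct [case_names GEnd GCom GVar GMu]:
  fixes G :: "('l, 'a, 'v) gtype"
  assumes "Q GEnd"
    and "\<And>p bs. (\<And>b. b \<in> set bs \<Longrightarrow> Q (snd (snd b))) \<Longrightarrow> Q (GCom p bs)"
    and "\<And>X. Q (GVar X)"
    and "\<And>X G. Q G \<Longrightarrow> Q (GMu X G)"
  shows "Q G"
proof (induction G)
  case (GCom p bs)
  show ?case by (rule assms(2), rule GCom) (auto simp: snds.simps)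
qed (use assms in auto)

text \<open>Unfolding of global types, which the typing judgement performs only on projections. It
  is meant for closed \<open>R\<close>, so no capture arises.\<close>

fun gsubst :: "'v \<Rightarrow> ('l, 'a, 'v) gtype \<Rightarrow> ('l, 'a, 'v) gtype \<Rightarrow> ('l, 'a, 'v) gtype" where
  "gsubst X R GEnd = GEnd"
| "gsubst X R (GCom p bs) =
     GCom p (map (\<lambda>b. (fst b, fst (snd b), gsubst X R (snd (snd b)))) bs)"
| "gsubst X R (GVar Y) = (if X = Y then R else GVar Y)"
| "gsubst X R (GMu Y G) = (if X = Y then GMu Y G else GMu Y (gsubst X R G))"

lemma gsubst_not_free: "X \<notin> gfv G \<Longrightarrow> gsubst X R G = G"
proof (induction G rule: gtype_induct)
  case (GCom p bs)
  then show ?case by (auto intro!: map_idI)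
qed auto

lemma gfv_gsubst: "gfv R = {} \<Longrightarrow> gfv (gsubst X R G) = gfv G - {X}"
  by (induction G rule: gtype_induct) (simp | fastforce)+

lemma is_gtype_gsubst: "is_gtype G \<Longrightarrow> is_gtype R \<Longrightarrow> is_gtype (gsubst X R G)"
proof (induction G rule: gtype_induct)
  case (GMu Y G)
  then show ?case by (cases G) (auto split: if_splits)
qed fastforce+

lemma pt_gsubst: "pt (gsubst X R G) \<subseteq> pt G \<union> pt R"
  by (induction G rule: gtype_induct) (simp | fastforce)+

lemma pt_gsubst_free: "X \<in> gfv G \<Longrightarrow> pt R \<subseteq> pt (gsubst X R G)"
  by (induction G rule: gtype_induct) (simp | fastforce)+

text \<open>Substitution may close an open recursion, and \<open>proj\<close> collapses a closed
  recursion without \<open>r\<close> to \<open>PEnd\<close>. With \<open>r\<close> in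
  \<open>pt R\<close> this cannot happen, by \<open>pt_gsubst_free\<close>.\<close>

lemma proj_gsubst:
  assumes "gfv R = {}" and "r \<in> pt R"
  shows "proj (gsubst X R G) r = psubst X (proj R r) (proj G r)"
proof (induction G rule: gtype_induct)
  case (GCom p bs)
  have IH: "proj (gsubst X R G) r = psubst X (proj R r) (proj G r)"
    if "(q, l, G) \<in> set bs" for q l G
    using GCom[OF that] by simp
  show ?case using IH by auto
next
  case (GMu Y G)
  show ?case
  proof (cases "X = Y \<or> X \<notin> gfv G")
    case True
    then have "gsubst X R (GMu Y G) = GMu Y G" by (auto simp: gsubst_not_free)
    \<comment> \<open>If \<open>X\<close> is not free in \<open>G\<close>, the induction hypothesis
      itself says that substitution fixes \<open>proj G r\<close>.\<close>
    moreover have "psubst X (proj R r) (proj (GMu Y G) r) = proj (GMu Y G) r"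
      using True GMu by (auto simp: gsubst_not_free)
    ultimately show ?thesis by simp
  next
    case False
    then have "r \<in> pt (gsubst X R G)"
      using pt_gsubst_free[of X G R] assms(2) by auto
    moreover have "gfv G - {Y} \<noteq> {}" using False by auto
    ultimately show ?thesis using False GMu by simp
  qed
qed auto

text \<open>The projection of a closed type on a non-participant is built from merges and
  \<open>PEnd\<close> only.\<close>

lemma typed_proj_not_pt:
  "gfv G = {} \<Longrightarrow> is_gtype G \<Longrightarrow> r \<notin> pt G \<Longrightarrow> typed P PEnd \<Longrightarrow> typed P (proj G r)"
proof (induction G rule: gtype_induct)
  case (GCom p bs)
  have "r \<noteq> p" using GCom(3,4) by (cases bs) auto
  moreover have "typed P (proj (snd (snd b)) r) \<and> r \<noteq> fst b" if "b \<in> set bs" for b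
    using GCom(1)[OF that] GCom(2-5) that by auto
  ultimately show ?case by (simp add: typed.mergeT)
qed auto

section \<open>Guardedness\<close>

lemma ptype_induct [case_names PEnd PSend PRecv PVar PMu PMerge]:
  fixes P :: "('l, 'a, 'v) ptype"
  assumes "Q PEnd"
    and "\<And>bs. (\<And>b. b \<in> set bs \<Longrightarrow> Q (snd (snd b))) \<Longrightarrow> Q (PSend bs)"
    and "\<And>p l P. Q P \<Longrightarrow> Q (PRecv p l P)"
    and "\<And>X. Q (PVar X)"
    and "\<And>X P. Q P \<Longrightarrow> Q (PMu X P)"
    and "\<And>Ps. (\<And>P. P \<in> set Ps \<Longrightarrow> Q P) \<Longrightarrow> Q (PMerge Ps)"
  shows "Q P"
proof (induction P)
  case (PSend bs)
  show ?case by (rule assms(2), rule PSend) (auto simp: snds.simps)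
qed (use assms in auto)

fun pfv :: "('l, 'a, 'v) ptype \<Rightarrow> 'v set" where
  "pfv PEnd = {}"
| "pfv (PSend bs) = (\<Union>b\<in>set bs. pfv (snd (snd b)))"
| "pfv (PRecv p l Q) = pfv Q"
| "pfv (PVar X) = {X}"
| "pfv (PMu X Q) = pfv Q - {X}"
| "pfv (PMerge Qs) = (\<Union>Q\<in>set Qs. pfv Q)"

lemma pfv_proj: "pfv (proj G r) \<subseteq> gfv G"
proof (induction G rule: gtype_induct)
  case (GCom p bs)
  then show ?case by (simp add: UN_subset_iff) blast
qed auto

text \<open>\<open>unguarded_vars\<close> does not remove the variable bound by a
  \<open>PMu\<close>; guardedness ensures that it is absent anyway.\<close>

lemma unguarded_vars_subset_pfv: "guarded Q \<Longrightarrow> unguarded_vars Q \<subseteq> pfv Q"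
proof (induction Q rule: ptype_induct)
  case (PMerge Qs)
  then show ?case by (simp add: UN_subset_iff) blast
qed auto

lemma unguarded_vars_psubst:
  "unguarded_vars (psubst X R Q) \<subseteq> unguarded_vars Q \<union> unguarded_vars R"
proof (induction Q rule: ptype_induct)
  case (PMerge Qs)
  then show ?case by (simp add: UN_subset_iff) blast
qed auto

lemma guarded_psubst:
  assumes "guarded R" and "unguarded_vars R = {}"
  shows "guarded Q \<Longrightarrow> guarded (psubst X R Q)"
proof (induction Q rule: ptype_induct)
  case (PMu Y Q)
  then show ?case using unguarded_vars_psubst[of X R Q] assms by auto
qed (use assms in auto)

text \<open>A closed guarded projection has no unguarded variables, so substituting it for
  \<open>X\<close> keeps all other recursions guarded.\<close>

lemma guarded_proj_unfold:
  assumes "gfv (GMu X G) = {}" and "r \<in> pt G" and "guarded (proj (GMu X G) r)"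
  shows "guarded (proj (gsubst X (GMu X G) G) r)"
proof -
  have "unguarded_vars (proj (GMu X G) r) = {}"
    using unguarded_vars_subset_pfv[OF assms(3)] pfv_proj[of "GMu X G" r] assms(1) by blast
  moreover have "guarded (proj G r)" using assms(2,3) by auto
  moreover have "proj (gsubst X (GMu X G) G) r = psubst X (proj (GMu X G) r) (proj G r)"
    by (rule proj_gsubst) (use assms in simp_all)
  ultimately show ?thesis using guarded_psubst[OF assms(3)] by metis
qed

lemma guarded_proj_branch:
  assumes "guarded (proj (GCom q bs) p)" and "(r, l, G) \<in> set bs"
  shows "guarded (proj G p)"
proof (cases "p = q")
  case True
  then show ?thesis using assms by fastforce
next
  case False
  then have "\<forall>b\<in>set bs. guarded (if p = fst b then PRecv q (fst (snd b)) (proj (snd (snd b)) p)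
      else proj (snd (snd b)) p)"
    using assms(1) by simp
  from bspec[OF this assms(2)] show ?thesis by (simp split: if_splits)
qed

text \<open>An upper bound for the number of steps in which \<open>p\<close> can be left out before the global type
  makes it move. Unfolding a guarded recursion does not change it, as the substituted variable
  only occurs below an action of \<open>p\<close>.\<close>

fun depth :: "'l \<Rightarrow> ('l, 'a, 'v) gtype \<Rightarrow> nat" where
  "depth p GEnd = 0"
| "depth p (GCom q bs) = (if p = q then 0 else
     Suc (\<Sum>b\<leftarrow>bs. if p = fst b then 0 else depth p (snd (snd b))))"
| "depth p (GVar X) = 0"
| "depth p (GMu X G) = Suc (depth p G)"

lemma depth_branch:
  assumes "p \<noteq> q" and "p \<noteq> q'" and "(q', l, G) \<in> set bs"
  shows "depth p G < depth p (GCom q bs)"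
proof -
  have "depth p G \<le> (\<Sum>b\<leftarrow>bs. if p = fst b then 0 else depth p (snd (snd b)))"
    using assms(2,3) by (intro member_le_sum_list) force+
  then show ?thesis using assms(1) by simp
qed

lemma depth_gsubst:
  "X \<notin> unguarded_vars (proj G p) \<Longrightarrow> depth p (gsubst X R G) = depth p G"
proof (induction G rule: gtype_induct)
  case (GCom q bs)
  show ?case
  proof (cases "p = q")
    case False
    have "depth p (gsubst X R (snd (snd b))) = depth p (snd (snd b))"
      if "b \<in> set bs" "p \<noteq> fst b" for b
      using GCom(1)[OF that(1)] GCom(2) that False by auto
    then show ?thesis using False by (auto simp: comp_def intro!: arg_cong[of _ _ sum_list])
  qed simp
next
  case (GMu Y G)
  then show ?case
    \<comment> \<open>If \<open>X\<close> is free in the recursion, that recursion is open, so its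
      projection is a \<open>PMu\<close> and exposes the unguarded variables of the body.\<close>
    by (cases "X \<in> gfv G") (auto simp: gsubst_not_free split: if_splits)
qed auto

lemma depth_unfold:
  assumes "p \<in> pt G" and "guarded (proj (GMu X G) p)"
  shows "depth p (gsubst X (GMu X G) G) < depth p (GMu X G)"
  using assms by (simp add: depth_gsubst)

section \<open>Paths and cuts\<close>

text \<open>Unlike \<open>comp\<close>, this ignores silent steps, which are local and do not
  constrain a cut.\<close>

fun comms :: "('l, 'a) act \<Rightarrow> 'l set" where
  "comms (Tau p) = {}"
| "comms (Comm p l q) = {p, q}"

lemma step_Tau:
  "step A (Tau x) B \<longleftrightarrow> (\<exists>P P'. A x = Some P \<and> ltau P P' \<and> B = A(x \<mapsto> P'))"
proof
  assume "step A (Tau x) B"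
  then show "\<exists>P P'. A x = Some P \<and> ltau P P' \<and> B = A(x \<mapsto> P')"
  proof cases
    case (choice bs k q l P)
    then have "(q, l, P) \<in> set bs" by (metis nth_mem)
    then show ?thesis using choice by (auto intro: ltau_choice)
  qed (fastforce intro: ltau_unfold)
next
  assume "\<exists>P P'. A x = Some P \<and> ltau P P' \<and> B = A(x \<mapsto> P')"
  then obtain P P' where "A x = Some P" "ltau P P'" and B: "B = A(x \<mapsto> P')" by blast
  from this(2,1) show "step A (Tau x) B" unfolding B
    by (cases rule: ltau.cases) (auto simp: in_set_conv_nth intro: step.intros)
qed

lemma step_Comm:
  "step A (Comm x l y) B \<longleftrightarrow> (\<exists>Q bs P. x \<noteq> y \<and> A x = Some (TSel y l Q) \<and>
     A y = Some (TRecv bs) \<and> (x, l, P) \<in> set bs \<and> B = A(x \<mapsto> Q, y \<mapsto> P))"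
proof
  assume "step A (Comm x l y) B"
  then show "\<exists>Q bs P. x \<noteq> y \<and> A x = Some (TSel y l Q) \<and>
     A y = Some (TRecv bs) \<and> (x, l, P) \<in> set bs \<and> B = A(x \<mapsto> Q, y \<mapsto> P)"
  proof cases
    case (comm Q bs k P)
    then have "(x, l, P) \<in> set bs" by (metis nth_mem)
    then show ?thesis using comm by blast
  qed
next
  assume "\<exists>Q bs P. x \<noteq> y \<and> A x = Some (TSel y l Q) \<and>
     A y = Some (TRecv bs) \<and> (x, l, P) \<in> set bs \<and> B = A(x \<mapsto> Q, y \<mapsto> P)"
  then show "step A (Comm x l y) B"
    by (auto simp: in_set_conv_nth intro: step.comm)
qed

lemma step_dom: "step A \<alpha> B \<Longrightarrow> dom B = dom A"
  by (cases \<alpha>) (auto simp: step_Tau step_Comm split: if_splits)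

lemma step_other: "step A \<alpha> B \<Longrightarrow> x \<notin> comp \<alpha> \<Longrightarrow> B x = A x"
  by (cases \<alpha>) (auto simp: step_Tau step_Comm)

lemma step_tstate:
  assumes "step A \<alpha> B" and "\<And>x P. A x = Some P \<Longrightarrow> tstate P" and "B x = Some P"
  shows "tstate P"
proof (cases \<alpha>)
  case (Tau y)
  then show ?thesis using assms tstate_ltau by (fastforce simp: step_Tau split: if_splits)
next
  case (Comm y l z)
  then obtain Q bs R where "A y = Some (TSel z l Q)" "A z = Some (TRecv bs)"
    "(y, l, R) \<in> set bs" and B: "B = A(y \<mapsto> Q, z \<mapsto> R)"
    using assms(1) by (auto simp: step_Comm)
  then have "tstate (TSel z l Q)" "tstate (TRecv bs)" using assms(2) by blast+
  then have "tstate Q" "tstate R"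
    using \<open>(y, l, R) \<in> set bs\<close> by (force simp: tstate_def)+
  then show ?thesis using assms(2,3) B by (auto split: if_splits)
qed

text \<open>A transition sees only the locations in \<open>comp\<close>, so it can be replayed in
  any state that agrees there. This is what permits reordering.\<close>

lemma step_local:
  assumes "step A \<alpha> B" and "\<And>x. x \<in> comp \<alpha> \<Longrightarrow> A' x = A x"
  shows "step A' \<alpha> (\<lambda>x. if x \<in> comp \<alpha> then B x else A' x)"
proof (cases \<alpha>)
  case (Tau y)
  then show ?thesis using assms by (fastforce simp: step_Tau)
next
  case (Comm y l z)
  then obtain Q bs R where "y \<noteq> z" "A y = Some (TSel z l Q)" "A z = Some (TRecv bs)"
    "(y, l, R) \<in> set bs" "B = A(y \<mapsto> Q, z \<mapsto> R)"
    using assms(1) by (auto simp: step_Comm)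
  then show ?thesis using Comm assms(2) by (fastforce simp: step_Comm)
qed

section \<open>Just paths of a race-free network\<close>

locale just_path =
  fixes N :: "('l, 'a, 'v) net" and s a and n :: enat
  assumes network: "is_network N"
    and race_free: "race_free N"
    and path: "is_path N s a n"
    and just: "just s a n"
begin

definition st :: "nat \<Rightarrow> 'l \<Rightarrow> ('l, 'a, 'v) thread" where
  "st k x = the (s k x)"

definition quiet :: "nat \<Rightarrow> nat \<Rightarrow> 'l \<Rightarrow> bool" where
  "quiet i j x \<longleftrightarrow> (\<forall>k. i \<le> k \<and> k < j \<longrightarrow> x \<notin> comms (a k))"

lemma path_step: "enat i < n \<Longrightarrow> step (s i) (a i) (s (Suc i))"
  using path by (simp add: is_path_def)

lemma le_lengthD: "enat (Suc i) \<le> n \<Longrightarrow> enat i < n"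
  by (simp add: Suc_ile_eq)

lemma le_length_trans: "i \<le> j \<Longrightarrow> enat j \<le> n \<Longrightarrow> enat i \<le> n"
  by (meson enat_ord_simps(1) order_trans)

lemma less_length_trans: "i < j \<Longrightarrow> enat j \<le> n \<Longrightarrow> enat i < n"
  by (meson enat_ord_simps(2) order_less_le_trans)

lemma invariants:
  "enat k \<le> n \<Longrightarrow> dom (s k) = dom N \<and> (\<forall>x P. s k x = Some P \<longrightarrow> tstate P)"
proof (induction k)
  case 0
  then show ?case using path network by (auto simp: is_path_def is_network_def tstate_def)
next
  case (Suc k)
  then have "step (s k) (a k) (s (Suc k))" "enat k \<le> n"
    by (auto simp: path_step le_lengthD intro: order_less_imp_le)
  then show ?case using Suc.IH step_dom step_tstate by metis
qed

lemma s_eq: "enat k \<le> n \<Longrightarrow> x \<in> dom N \<Longrightarrow> s k x = Some (st k x)"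
  by (metis domD invariants option.sel st_def)

lemma s_None: "enat k \<le> n \<Longrightarrow> x \<notin> dom N \<Longrightarrow> s k x = None"
  by (metis domIff invariants)

lemma tstate_st: "enat k \<le> n \<Longrightarrow> x \<in> dom N \<Longrightarrow> tstate (st k x)"
  by (metis invariants s_eq)

lemma unaffected:
  assumes "i \<le> j" and "enat j \<le> n" and "\<And>k. i \<le> k \<Longrightarrow> k < j \<Longrightarrow> x \<notin> comp (a k)"
  shows "s j x = s i x"
  using assms
proof (induction rule: dec_induct)
  case (step k)
  then have "s (Suc k) x = s k x" by (intro step_other) (auto simp: path_step le_lengthD)
  then show ?case using step le_length_trans[of k "Suc k"] by simp
qed simp

lemma quiet_ltaus:
  assumes "i \<le> j" and "enat j \<le> n" and "quiet i j x" and "x \<in> dom N"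
  shows "ltau\<^sup>*\<^sup>* (st i x) (st j x)"
  using assms
proof (induction rule: dec_induct)
  case (step k)
  then have k: "enat k < n" "enat k \<le> n" by (auto simp: le_lengthD intro: order_less_imp_le)
  have IH: "ltau\<^sup>*\<^sup>* (st i x) (st k x)"
    using step k by (auto simp: quiet_def)
  have "x \<notin> comms (a k)" using step by (auto simp: quiet_def)
  then have "st (Suc k) x = st k x \<or> ltau (st k x) (st (Suc k) x)"
    using path_step[OF k(1)] step_other[OF path_step[OF k(1)], of x]
    by (cases "a k") (auto simp: step_Tau st_def)
  then show ?case using IH by auto
qed simp

lemma quiet_stuck:
  assumes "i \<le> j" and "enat j \<le> n" and "quiet i j x" and "x \<in> dom N" and "rank (st i x) = 0"
  shows "st j x = st i x"
  using quiet_ltaus[OF assms(1-4)] assms(5) rank_zero_stuck by blast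

text \<open>While the rank is positive, a silent step of \<open>x\<close> is enabled and justness
  makes \<open>x\<close> move. It cannot communicate yet, so its next move is silent and lowers the
  rank.\<close>

lemma settle:
  assumes "enat k \<le> n" and "x \<in> dom N"
  shows "\<exists>j\<ge>k. enat j \<le> n \<and> quiet k j x \<and> rank (st j x) = 0"
  using assms(1)
proof (induction "rank (st k x)" arbitrary: k rule: less_induct)
  case less
  show ?case
  proof (cases "rank (st k x) = 0")
    case True
    then show ?thesis using less.prems by (auto simp: quiet_def)
  next
    case False
    then obtain P' where "ltau (st k x) P'"
      using ltau_exists tstate_st less.prems assms(2) by blast
    then have "step (s k) (Tau x) ((s k)(x \<mapsto> P'))"
      using s_eq less.prems assms(2) by (auto simp: step_Tau)
    then obtain j0 where "k \<le> j0 \<and> enat j0 < n \<and> x \<in> comp (a j0)"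
      using just less.prems unfolding just_def by fastforce
    \<comment> \<open>The first such step is taken, so that \<open>x\<close> is still in state
      \<open>st k x\<close> before it.\<close>
    then obtain j where j: "k \<le> j" "enat j < n" "x \<in> comp (a j)"
      and min: "\<And>i. i < j \<Longrightarrow> \<not> (k \<le> i \<and> enat i < n \<and> x \<in> comp (a i))"
      using exists_least_iff[of "\<lambda>j. k \<le> j \<and> enat j < n \<and> x \<in> comp (a j)"] by blast
    have jn: "enat j \<le> n" "enat (Suc j) \<le> n"
      using j(2) by (auto simp: Suc_ile_eq intro: order_less_imp_le)
    have idle: "x \<notin> comp (a i)" if "k \<le> i" "i < j" for i
      using min[of i] that less_length_trans[OF that(2) jn(1)] by blast
    have sj: "s j x = Some (st k x)"
      using unaffected[OF j(1) jn(1) idle] s_eq less.prems assms(2) by simp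
    have "ltau (st k x) (st (Suc j) x) \<and> x \<notin> comms (a j)"
    proof (cases "a j")
      case (Tau y)
      then show ?thesis using path_step[OF j(2)] j(3) sj by (auto simp: step_Tau st_def)
    next
      case (Comm y l z)
      \<comment> \<open>The partners of a communication are a \<open>TSel\<close> and a
        \<open>TRecv\<close>, both of rank 0.\<close>
      then have "rank (the (s j x)) = 0"
        using path_step[OF j(2)] j(3) by (auto simp: step_Comm)
      then show ?thesis using sj False by simp
    qed
    then have lt: "rank (st (Suc j) x) < rank (st k x)" and nc: "x \<notin> comms (a j)"
      using rank_ltau tstate_st less.prems assms(2) by blast+
    obtain j' where j': "Suc j \<le> j'" "enat j' \<le> n" "quiet (Suc j) j' x" "rank (st j' x) = 0"
      using less.hyps[OF lt jn(2)] by blast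
    have comp: "x \<notin> comp (a i) \<Longrightarrow> x \<notin> comms (a i)" for i by (cases "a i") auto
    have "quiet k j' x" unfolding quiet_def
    proof (intro allI impI)
      fix i assume i: "k \<le> i \<and> i < j'"
      consider "i < j" | "i = j" | "Suc j \<le> i" by linarith
      then show "x \<notin> comms (a i)"
        using i idle comp nc j'(3) by cases (auto simp: quiet_def)
    qed
    then show ?thesis using j' j(1) by (meson Suc_leD order_trans)
  qed
qed

section \<open>Consistent cuts\<close>

definition consistent :: "('l \<Rightarrow> nat) \<Rightarrow> bool" where
  "consistent t \<longleftrightarrow> (\<forall>j x l y. enat j < n \<longrightarrow> a j = Comm x l y \<longrightarrow> (j < t x \<longleftrightarrow> j < t y))"

lemma consistent_comms:
  assumes "consistent t" and "enat j < n" and "x \<in> comms (a j)" and "y \<in> comms (a j)"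
  shows "j < t x \<longleftrightarrow> j < t y"
proof (cases "a j")
  case (Comm u l v)
  then have "j < t u \<longleftrightarrow> j < t v" using assms(1,2) by (simp add: consistent_def)
  then show ?thesis using assms(3,4) Comm by auto
qed (use assms in simp)

text \<open>Executing only those steps of the path that lie below a consistent cut reorders concurrent
  transitions, hence yields a reachable state.\<close>

lemma reachable_cut:
  assumes "consistent t" and t: "\<And>x. enat (t x) \<le> n"
  shows "reachable N (\<lambda>x. s (t x) x)"
proof -
  \<comment> \<open>\<open>M k\<close> follows the first \<open>k\<close> steps of the path, with
    each location \<open>x\<close> frozen from time \<open>t x\<close> on.\<close>
  define M where "M k = (\<lambda>x. s (min (t x) k) x)" for k
  have reach: "enat k \<le> n \<Longrightarrow> reachable N (M k)" for k
  proof (induction k)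
    case 0
    have "M 0 = N" using path by (auto simp: M_def is_path_def)
    then show ?case by (simp add: reachable_def)
  next
    case (Suc k)
    then have k: "enat k < n" "enat k \<le> n" by (auto simp: le_lengthD intro: order_less_imp_le)
    note st = path_step[OF k(1)]
    have same: "s (Suc k) x = s k x" if "x \<notin> comp (a k)" for x
      using step_other[OF st that] .
    \<comment> \<open>Step \<open>k\<close> lies below the cut for all locations that it moves, and
      is replayed, or for none of them, and is skipped.\<close>
    have "M (Suc k) = M k \<or> step (M k) (a k) (M (Suc k))"
    proof (cases "\<exists>x\<in>comp (a k). k < t x")
      case True
      then obtain y where y: "y \<in> comp (a k)" "k < t y" by blast
      have lt: "k < t x" if "x \<in> comp (a k)" for x
        using consistent_comms[OF assms(1) k(1), of x y] y that by (cases "a k") simp_all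
      have "step (M k) (a k) (\<lambda>x. if x \<in> comp (a k) then s (Suc k) x else M k x)"
        by (rule step_local[OF st]) (simp add: M_def lt less_imp_le)
      moreover have "(\<lambda>x. if x \<in> comp (a k) then s (Suc k) x else M k x) = M (Suc k)"
      proof
        fix x
        show "(if x \<in> comp (a k) then s (Suc k) x else M k x) = M (Suc k) x"
          using lt[of x] same[of x] by (auto simp: M_def min_def not_less_eq_eq le_Suc_eq)
      qed
      ultimately show ?thesis by simp
    next
      case False
      have "M (Suc k) x = M k x" for x
        using False same[of x] by (cases "x \<in> comp (a k)") (auto simp: M_def min_def le_Suc_eq)
      then show ?thesis by blast
    qed
    then show ?case using Suc.IH[OF k(2)] unfolding reachable_def
      by (auto intro: rtranclp.rtrancl_into_rtrancl)
  qed
  \<comment> \<open>The network is finite, so one index bounds all cut times of its locations;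
    \<open>0\<close> covers the empty network.\<close>
  define K where "K = Max (insert 0 (t ` dom N))"
  have fin: "finite (dom N)" using network by (simp add: is_network_def)
  then have K: "x \<in> dom N \<Longrightarrow> t x \<le> K" for x by (simp add: K_def)
  have "K \<in> insert 0 (t ` dom N)" unfolding K_def using fin by (intro Max_in) auto
  then have Kn: "enat K \<le> n" using t by (auto simp: zero_enat_def[symmetric])
  have "M K = (\<lambda>x. s (t x) x)"
  proof
    fix x
    show "M K x = s (t x) x"
    proof (cases "x \<in> dom N")
      case True
      then show ?thesis using K by (simp add: M_def)
    next
      case False
      then show ?thesis using s_None t Kn le_length_trans[of "min (t x) K" K]
        by (simp add: M_def)
    qed
  qed
  then show ?thesis using reach[OF Kn] by simp
qed

lemma no_race:
  assumes "consistent t" and "\<And>x. enat (t x) \<le> n"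
    and "step (\<lambda>x. s (t x) x) (Comm p l r) M" and "step (\<lambda>x. s (t x) x) (Comm q m r) M'"
  shows "p = q \<and> M = M'"
  using race_free reachable_cut[OF assms(1,2)] assms(3,4)
  unfolding race_free_def has_race_def by blast

section \<open>Following a global type\<close>

definition follows :: "('l \<Rightarrow> nat) \<Rightarrow> ('l, 'a, 'v) gtype \<Rightarrow> bool" where
  "follows t G \<longleftrightarrow> is_gtype G \<and> gfv G = {} \<and> pt G \<subseteq> dom N \<and> (\<forall>x. enat (t x) \<le> n) \<and>
     consistent t \<and> (\<forall>x\<in>dom N. typed (st (t x) x) (proj G x))"

text \<open>The cut stays in place. For participants, unfolding commutes with projection; for the
  others, the old projection is \<open>PEnd\<close> and \<open>typed_proj_not_pt\<close>
  applies.\<close>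

lemma follows_unfold:
  assumes "follows t (GMu X G)"
  shows "follows t (gsubst X (GMu X G) G)"
proof -
  let ?R = "GMu X G"
  have R: "is_gtype ?R" "gfv ?R = {}" "pt ?R \<subseteq> dom N" and t: "\<And>x. enat (t x) \<le> n"
    and ty: "\<And>x. x \<in> dom N \<Longrightarrow> typed (st (t x) x) (proj ?R x)"
    using assms unfolding follows_def by blast+
  have G': "is_gtype (gsubst X ?R G)" "gfv (gsubst X ?R G) = {}"
    using R is_gtype_gsubst[of G ?R X] gfv_gsubst[of ?R X G] by auto
  have "typed (st (t x) x) (proj (gsubst X ?R G) x)" if x: "x \<in> dom N" for x
  proof (cases "x \<in> pt G")
    case True
    then have e: "proj ?R x = PMu X (proj G x)" by simp
    have "proj (gsubst X ?R G) x = psubst X (PMu X (proj G x)) (proj G x)"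
      using proj_gsubst[OF R(2), of x X G] True unfolding e by simp
    then show ?thesis using typed_PMu[OF _ tstate_st[OF t x]] ty[OF x] unfolding e by simp
  next
    case False
    then have "x \<notin> pt (gsubst X ?R G)" using pt_gsubst[of X ?R G] by auto
    moreover have "typed (st (t x) x) PEnd" using ty[OF x] False R(2) by simp
    ultimately show ?thesis by (intro typed_proj_not_pt G')
  qed
  moreover have "pt (gsubst X ?R G) \<subseteq> dom N" using pt_gsubst[of X ?R G] R(3) by auto
  ultimately show ?thesis using G' assms unfolding follows_def by blast
qed

text \<open>By justness the sender and receiver of the first action of the global type both become
  ready for it. If the receiver were to interact with a third party instead, that
  interaction could be reordered before the action, which would make the two race.\<close>

lemma advance:
  assumes "follows t (GCom p bs)"
  obtains T q l G where "(q, l, G) \<in> set bs" and "enat T < n" and "a T = Comm p l q"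
    and "t p \<le> T" and "t q \<le> T" and "follows (t(p := Suc T, q := Suc T)) G"
proof -
  let ?G = "GCom p bs"
  have gt': "is_gtype ?G" and closed: "gfv ?G = {}" and pt: "pt ?G \<subseteq> dom N"
    and t: "\<And>x. enat (t x) \<le> n" and con: "consistent t"
    and ty: "\<And>x. x \<in> dom N \<Longrightarrow> typed (st (t x) x) (proj ?G x)"
    using assms unfolding follows_def by blast+
  then have ne: "bs \<noteq> []" and gt: "\<And>b. b \<in> set bs \<Longrightarrow> fst b \<noteq> p \<and> is_gtype (snd (snd b))"
    by simp_all
  have p: "p \<in> dom N" using pt ne by (cases bs) auto
  \<comment> \<open>Once \<open>p\<close> has settled, its type forces a selected output, and this
    selection determines the branch \<open>G\<close>.\<close>
  obtain kp where kp: "t p \<le> kp" "enat kp \<le> n" "quiet (t p) kp p" "rank (st kp p) = 0"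
    using settle[OF t p] by blast
  have "typed (st kp p) (PSend (map (\<lambda>b. (fst b, fst (snd b), proj (snd (snd b)) p)) bs))"
    using typed_ltaus[OF quiet_ltaus[OF kp(1-3) p] ty[OF p]] by simp
  then obtain q l Q R where stp: "st kp p = TSel q l R" and R: "typed R Q"
    and "(q, l, Q) \<in> set (map (\<lambda>b. (fst b, fst (snd b), proj (snd (snd b)) p)) bs)"
    by (rule typed_PSend_rank0[OF _ kp(4)])
  then obtain G where G: "(q, l, G) \<in> set bs" and Q: "Q = proj G p"
    by auto
  have qp: "q \<noteq> p" using gt[OF G] by simp
  have "{p, fst (q, l, G)} \<union> pt (snd (snd (q, l, G))) \<subseteq> pt ?G"
    unfolding pt.simps by (rule UN_upper[OF G])
  then have q: "q \<in> dom N" and ptG: "pt G \<subseteq> dom N" using pt by auto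
  have "gfv (snd (snd (q, l, G))) \<subseteq> gfv ?G"
    unfolding gfv.simps by (rule UN_upper[OF G])
  then have closedG: "gfv G = {}" using closed by simp
  \<comment> \<open>Every location other than \<open>p\<close> is typed by all merged branches,
    hence by the one that \<open>p\<close> has selected.\<close>
  have merge: "typed (st (t x) x) (if x = q then PRecv p l (proj G x) else proj G x)"
    if "x \<in> dom N" "x \<noteq> p" for x
  proof -
    have "typed (st (t x) x) (PMerge (map (\<lambda>b. if x = fst b
        then PRecv p (fst (snd b)) (proj (snd (snd b)) x) else proj (snd (snd b)) x) bs))"
      using ty[OF that(1)] that(2) by simp
    then show ?thesis
      by (rule typed_PMerge[OF _ tstate_st[OF t that(1)]]) (use G in force)
  qed
  obtain kq where kq: "t q \<le> kq" "enat kq \<le> n" "quiet (t q) kq q" "rank (st kq q) = 0"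
    using settle[OF t q] by blast
  have "typed (st kq q) (PRecv p l (proj G q))"
    using typed_ltaus[OF quiet_ltaus[OF kq(1-3) q]] merge[OF q qp] by simp
  then obtain cs S where stq: "st kq q = TRecv cs" and S: "(p, l, S) \<in> set cs" "typed S (proj G q)"
    by (rule typed_PRecv_rank0[OF _ kq(4)])
  define ev where
    "ev T \<longleftrightarrow> enat T < n \<and> (p \<in> comms (a T) \<and> t p \<le> T \<or> q \<in> comms (a T) \<and> t q \<le> T)" for T
  \<comment> \<open>Otherwise \<open>p\<close> and \<open>q\<close> would stay ready forever.
    Justness for their enabled communication forces one of them to move, which can be neither a
    silent step nor a communication.\<close>
  have "\<exists>T. ev T"
  proof (rule ccontr)
    assume nev: "\<not> (\<exists>T. ev T)"
    have still: "s j p = Some (TSel q l R)" "s j q = Some (TRecv cs)"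
      if "max kp kq \<le> j" "enat j \<le> n" for j
    proof -
      have "quiet kp j p" "quiet kq j q"
        using nev kp(1) kq(1) less_length_trans[OF _ that(2)] unfolding quiet_def ev_def
        by (meson order_trans)+
      then show "s j p = Some (TSel q l R)" "s j q = Some (TRecv cs)"
        using quiet_stuck[of kp j p] quiet_stuck[of kq j q] that kp kq p q s_eq[OF that(2)]
        by (auto simp: stp stq)
    qed
    let ?k = "max kp kq"
    have kn: "enat ?k \<le> n" using kp(2) kq(2) by (simp add: max_def)
    have "\<exists>M. step (s ?k) (Comm p l q) M"
      unfolding step_Comm using still[OF order_refl kn] qp S(1) by blast
    then obtain j where j: "?k \<le> j" "enat j < n" "comp (a j) \<inter> {p, q} \<noteq> {}"
      using just kn unfolding just_def by fastforce
    note sj = still[OF j(1) order_less_imp_le[OF j(2)]]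
    show False
    proof (cases "a j")
      case (Tau x)
      then show False using path_step[OF j(2)] sj j(3) by (auto simp: step_Tau elim: ltau.cases)
    next
      case (Comm x m y)
      then have "ev j" using j kp(1) kq(1) by (auto simp: ev_def)
      then show False using nev by blast
    qed
  qed
  then obtain T where ev: "ev T" and min: "\<And>j. j < T \<Longrightarrow> \<not> ev j"
    using exists_least_iff[of ev] by blast
  have Tn: "enat T < n" "enat T \<le> n" using ev by (auto simp: ev_def intro: order_less_imp_le)
  \<comment> \<open>By minimality of \<open>T\<close>, earlier communications of \<open>p\<close>
    and \<open>q\<close> lie in the past of the cut.\<close>
  have before: "j < t x" if "j < T" "x \<in> {p, q}" "x \<in> comms (a j)" for j x
    using min[OF that(1)] that less_length_trans[OF that(1) Tn(2)]
    by (auto simp: ev_def not_le)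
  have ready_p: "kp \<le> T \<and> st T p = TSel q l R" if "t p \<le> T" "p \<in> comms (a T)"
  proof -
    have "kp \<le> T" using kp(3) that unfolding quiet_def by (meson not_le)
    moreover from this have "quiet kp T p"
      unfolding quiet_def using before kp(1) by (meson insertI1 le_trans not_le)
    ultimately show ?thesis using quiet_stuck[of kp T p] Tn(2) p kp(4) by (simp add: stp)
  qed
  have ready_q: "kq \<le> T \<and> st T q = TRecv cs" if "t q \<le> T" "q \<in> comms (a T)"
  proof -
    have "kq \<le> T" using kq(3) that unfolding quiet_def by (meson not_le)
    moreover from this have "quiet kq T q"
      unfolding quiet_def using before kq(1) by (meson insertI1 insertI2 le_trans not_le)
    ultimately show ?thesis using quiet_stuck[of kq T q] Tn(2) q kq(4) by (simp add: stq)
  qed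
  note stT = path_step[OF Tn(1)]
  have pT: "p \<in> comms (a T)"
  proof (rule ccontr)
    assume np: "p \<notin> comms (a T)"
    then have qT: "q \<in> comms (a T)" "t q \<le> T" using ev by (auto simp: ev_def)
    have sq: "s T q = Some (TRecv cs)" using ready_q[OF qT(2,1)] s_eq[OF Tn(2) q] by simp
    obtain x m y where a: "a T = Comm x m y" using qT(1) by (cases "a T") auto
    then obtain U V where xU: "x \<noteq> y" "s T x = Some (TSel y m U)" and V: "(x, m, V) \<in> set cs"
      and yq: "y = q"
      using stT qT(1) sq by (auto simp: step_Comm)
    have xp: "x \<noteq> p" using np a by auto
    have "t x \<le> T" using con Tn(1) a yq qT(2) unfolding consistent_def by (meson not_le)
    \<comment> \<open>At this cut \<open>p\<close> is ready to send to \<open>q\<close>,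
      \<open>q\<close> is ready to receive, and \<open>x\<close>, at time \<open>T\<close>, is about
      to send to \<open>q\<close> too: a race.\<close>
    define u where "u = (\<lambda>z. if z = p then kp else if z = q then kq else max (t z) T)"
    \<comment> \<open>As far as communications are concerned, \<open>u z\<close> acts like the
      maximum of \<open>t z\<close> and \<open>T\<close>, even for \<open>p\<close> and
      \<open>q\<close>; consistency of \<open>u\<close> follows.\<close>
    have u: "j < u z \<longleftrightarrow> j < t z \<or> j < T" if "z \<in> comms (a j)" for j z
    proof -
      have "j < kp \<Longrightarrow> j < t p" if "z = p"
        using kp(3) \<open>z \<in> comms (a j)\<close> that unfolding quiet_def by (meson not_le)
      moreover have "j < kq \<Longrightarrow> j < t q" if "z = q"
        using kq(3) \<open>z \<in> comms (a j)\<close> that unfolding quiet_def by (meson not_le)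
      ultimately show ?thesis
        using before[of j z] that kp(1) kq(1) by (auto simp: u_def)
    qed
    have con_u: "consistent u" unfolding consistent_def
    proof (intro allI impI)
      fix j z k w assume j: "enat j < n" "a j = Comm z k w"
      then have "j < t z \<longleftrightarrow> j < t w" using con by (auto simp: consistent_def)
      then show "j < u z \<longleftrightarrow> j < u w" using u[of z j] u[of w j] j(2) by simp
    qed
    have un: "\<And>z. enat (u z) \<le> n" using kp(2) kq(2) t Tn(2) by (simp add: u_def max_def)
    have cut: "s (u p) p = Some (TSel q l R)" "s (u q) q = Some (TRecv cs)"
      "s (u x) x = Some (TSel q m U)"
      using s_eq kp(2) kq(2) p q stp stq qp xp xU yq \<open>t x \<le> T\<close> by (auto simp: u_def max_def)
    obtain M where M: "step (\<lambda>z. s (u z) z) (Comm p l q) M"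
      using cut qp S(1) by (auto simp: step_Comm)
    obtain M' where M': "step (\<lambda>z. s (u z) z) (Comm x m q) M'"
      using cut xU(1) yq V by (auto simp: step_Comm)
    have "p = x \<and> M = M'" by (rule no_race[OF con_u un M M'])
    then show False using xp by simp
  qed
  have tp: "t p \<le> T"
    using ev pT consistent_comms[OF con Tn(1), of p q] by (auto simp: ev_def not_less[symmetric])
  have sp: "s T p = Some (TSel q l R)" using ready_p[OF tp pT] s_eq[OF Tn(2) p] by simp
  have a: "a T = Comm p l q"
    using stT pT sp by (cases "a T") (auto simp: step_Comm)
  have tq: "t q \<le> T"
    using tp con Tn(1) a unfolding consistent_def by (meson not_le)
  have sq: "s T q = Some (TRecv cs)" using ready_q[OF tq] a s_eq[OF Tn(2) q] by simp
  obtain V where V: "(p, l, V) \<in> set cs" and sT: "s (Suc T) = (s T)(p \<mapsto> R, q \<mapsto> V)"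
    using stT sp sq unfolding a by (auto simp: step_Comm)
  \<comment> \<open>Typing provides the continuation \<open>S\<close>, while the path may have taken
    another branch with the same sender and label. Race-freedom at the constant cut \<open>T\<close>
    identifies the two resulting states.\<close>
  have "step (s T) (Comm p l q) ((s T)(p \<mapsto> R, q \<mapsto> S))"
    using sp sq qp S(1) by (auto simp: step_Comm)
  moreover have "consistent (\<lambda>_. T)" by (simp add: consistent_def)
  ultimately have "s (Suc T) = (s T)(p \<mapsto> R, q \<mapsto> S)"
    using no_race[of "\<lambda>_. T"] stT Tn(2) unfolding a by blast
  then have next_st: "st (Suc T) p = R" "st (Suc T) q = S"
    using qp by (auto simp: st_def)
  let ?t = "t(p := Suc T, q := Suc T)"
  have "consistent ?t" unfolding consistent_def
  proof (intro allI impI)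
    fix j x m y assume j: "enat j < n" "a j = Comm x m y"
    show "j < ?t x \<longleftrightarrow> j < ?t y"
    proof (cases "j = T")
      case True
      then show ?thesis using j(2) a by auto
    next
      case False
      have "j < ?t z \<longleftrightarrow> j < t z" if "z \<in> comms (a j)" for z
        using before[of j z] that False tp tq by auto
      then show ?thesis using con j unfolding consistent_def by simp
    qed
  qed
  moreover have "typed (st (?t x) x) (proj G x)" if "x \<in> dom N" for x
    using merge[OF that] next_st R S(2) Q by auto
  moreover have "is_gtype G" using gt[OF G] by simp
  moreover have "enat (?t x) \<le> n" for x using t Tn(1) by (simp add: Suc_ile_eq)
  ultimately have "follows ?t G" using closedG ptG unfolding follows_def by blast
  then show ?thesis using that[OF G Tn(1) a tp tq] by blast
qed

section \<open>Absence of starvation\<close>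

text \<open>Infinite descent on the number of steps of \<open>p\<close> beyond the cut, then on
  \<open>depth p G\<close>. Advancing past a communication of \<open>p\<close> lowers the first;
  advancing past any other, or unfolding, keeps \<open>t p\<close> and lowers the second.\<close>

lemma no_starvation:
  assumes p: "p \<in> dom N" and fin: "finite {j. enat j < n \<and> p \<in> comp (a j)}"
    and no_end: "\<And>i. enat i \<le> n \<Longrightarrow> s i p \<noteq> Some TEnd"
  shows "follows t G \<Longrightarrow> \<not> guarded (proj G p)"
proof (induction "(t, G)" arbitrary: t G
    rule: wf_induct[OF wf_measures[of "[\<lambda>(t, G). card {j. enat j < n \<and> p \<in> comp (a j) \<and> t p \<le> j},
      \<lambda>(t, G). depth p G]"], consumes 0])
  case (1 t G)
  have IH: "\<not> guarded (proj G' p)"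
    if "follows t' G'" and "card {j. enat j < n \<and> p \<in> comp (a j) \<and> t' p \<le> j}
        < card {j. enat j < n \<and> p \<in> comp (a j) \<and> t p \<le> j} \<or>
      t' p = t p \<and> depth p G' < depth p G" for t' G'
  proof -
    have "((t', G'), (t, G)) \<in> measures [\<lambda>(t, G). card {j. enat j < n \<and> p \<in> comp (a j) \<and> t p \<le> j},
        \<lambda>(t, G). depth p G]"
      using that(2) by (elim disjE conjE) simp_all
    from 1(1)[rule_format, OF this refl that(1)] show ?thesis .
  qed
  have t: "enat (t p) \<le> n" and ty: "typed (st (t p) p) (proj G p)"
    using 1(2) p by (auto simp: follows_def)
  obtain k where k: "t p \<le> k" "enat k \<le> n" "quiet (t p) k p" "rank (st k p) = 0"
    using settle[OF t p] by blast
  have not_end: "proj G p \<noteq> PEnd"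
    using typed_PEnd_rank0[OF _ k(4)] typed_ltaus[OF quiet_ltaus[OF k(1-3) p] ty]
      no_end[OF k(2)] s_eq[OF k(2) p] by auto
  show ?case
  proof (cases G)
    case (GCom q bs)
    obtain T r l G' where G': "(r, l, G') \<in> set bs" and T: "enat T < n" "a T = Comm q l r"
      "t q \<le> T" "t r \<le> T" and fol: "follows (t(q := Suc T, r := Suc T)) G'"
      by (rule advance[OF 1(2)[unfolded GCom]])
    have "\<not> guarded (proj G' p)"
    proof (rule IH[OF fol])
      show "card {j. enat j < n \<and> p \<in> comp (a j) \<and> (t(q := Suc T, r := Suc T)) p \<le> j}
          < card {j. enat j < n \<and> p \<in> comp (a j) \<and> t p \<le> j} \<or>
        (t(q := Suc T, r := Suc T)) p = t p \<and> depth p G' < depth p G"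
      proof (cases "p = q \<or> p = r")
        case True
        then have pT: "p \<in> comp (a T)" "t p \<le> T" using T(2-4) by auto
        let ?E = "\<lambda>i. {j. enat j < n \<and> p \<in> comp (a j) \<and> i \<le> j}"
        have "T \<in> ?E (t p)" "T \<notin> ?E (Suc T)" using pT T(1) by simp_all
        moreover have "?E (Suc T) \<subseteq> ?E (t p)"
          by (intro Collect_mono) (use pT(2) in linarith)
        ultimately have "?E (Suc T) \<subset> ?E (t p)" by blast
        moreover have "finite (?E (t p))" by (rule finite_subset[OF _ fin]) blast
        ultimately have "card (?E (Suc T)) < card (?E (t p))" by (intro psubset_card_mono)
        moreover have "(t(q := Suc T, r := Suc T)) p = Suc T" using True by auto
        ultimately show ?thesis by simp
      next
        case False
        then show ?thesis using depth_branch[OF _ _ G', of p q] GCom by simp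
      qed
    qed
    then show ?thesis using guarded_proj_branch[OF _ G'] GCom by blast
  next
    case (GMu X H)
    \<comment> \<open>The projection is not \<open>PEnd\<close>, so this closed recursion has
      \<open>p\<close> as a participant.\<close>
    then have closed: "gfv (GMu X H) = {}" and pt: "p \<in> pt H"
      using 1(2) not_end by (auto simp: follows_def split: if_splits)
    show ?thesis
    proof
      assume g: "guarded (proj G p)"
      then have "guarded (proj (gsubst X (GMu X H) H) p)"
        using guarded_proj_unfold[OF closed pt] GMu by simp
      moreover have "depth p (gsubst X (GMu X H) H) < depth p G"
        using depth_unfold[OF pt] g GMu by simp
      ultimately show False using IH follows_unfold 1(2) GMu by blast
    qed
  qed (use not_end 1(2) in \<open>auto simp: follows_def\<close>)
qed

end

theorem mainTheorem2:
  fixes N :: "('l, 'a, 'v) net"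
  assumes "is_network N"
    and "guardedly_well_typed N"
    and "race_free N"
  shows "satisfies_LJ N"
  unfolding satisfies_LJ_def
proof (intro allI impI ballI)
  fix s a n p
  assume pj: "is_path N s a n \<and> just s a n" and p: "p \<in> dom N"
  then interpret just_path N s a n using assms by unfold_locales auto
  obtain G where G: "is_gtype G" "net_typed N G" "guarded (proj G p)"
    using assms(2) p by (auto simp: guardedly_well_typed_def net_gtyped_def)
  \<comment> \<open>The cut at time 0 has an empty past, so it splits no communication.\<close>
  have "follows (\<lambda>_. 0) G"
    using G(1,2) path
    by (auto simp: follows_def net_typed_def consistent_def is_path_def st_def zero_enat_def[symmetric])
  then show "(\<exists>i. enat i \<le> n \<and> s i p = Some TEnd) \<or> infinite {j. enat j < n \<and> p \<in> comp (a j)}"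
    using no_starvation[OF p] G(3) by blast
qed

end
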